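(* Fix a dimension $d\ge 2$. There is a constant $c_d$ depending only on $d$ such that for every $\gamma>0$ there is a constant $C$ depending only on $\gamma$ and $d$ with the following property. Let $n\ge 2$, and let $Q=\langle q_1,\dots,q_n\rangle$ be an ordered set of $n$ points picked randomly from $[0,1]^d$ according to the sampling model. Let $Q_i=\{q_1,\dots,q_i\}$ be the underlying set of the $i$-th prefix of $Q$. Then (i) with probability at least $1-n^{-\gamma}$, $\left|\bigcup_{i=1}^n \mathrm{St}(Q_i)\right|\le C\,c_d\log^{d} n$; and (ii) with probability at least $1-n^{-\gamma}$, $|\mathrm{St}(\{q_1,\dots,q_n\})|\le C\,c_d\log^{d-1} n$.
   Context: Sampling model: the points are independent. For each point, its $j$-th coordinate is drawn from a continuous (atomless) distribution $\mathcal{D}_j$ on $[0,1]$ (the same $\mathcal{D}_j$ for all points), independently over $j=1,\dots,d$. All sampled values are assumed distinct. For $p,q\in\mathbb{R}^d$, $p$ dominates $q$ if $p_i\le q_i$ for all $i$. For a point set $P\subseteq\mathbb{R}^d$, the staircase $\mathrm{St}(P)$ is the set of points of $P$ that are not dominated by any other point of $P$. *)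

theory Defs
  imports "HOL-Probability.Probability"
begin

text \<open>
  A point of \<open>\<real>\<^sup>d\<close> is a function on the coordinates \<open>{1..d}\<close>, extended by
  \<^const>\<open>undefined\<close> outside (as in \<^const>\<open>PiE\<close> and \<^const>\<open>PiM\<close>), so that the dimension
  can be an ordinary natural number.
\<close>

definition dominates :: "nat \<Rightarrow> (nat \<Rightarrow> real) \<Rightarrow> (nat \<Rightarrow> real) \<Rightarrow> bool" where
  "dominates d p q \<longleftrightarrow> (\<forall>j\<in>{1..d}. p j \<le> q j)"

definition staircase :: "nat \<Rightarrow> (nat \<Rightarrow> real) set \<Rightarrow> (nat \<Rightarrow> real) set" where
  "staircase d P = {p \<in> P. \<not> (\<exists>q\<in>P. q \<noteq> p \<and> dominates d q p)}"

definition atomless_unit_distribution :: "real measure \<Rightarrow> bool" where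
  "atomless_unit_distribution M \<longleftrightarrow>
     real_distribution M \<and> measure M {0..1} = 1 \<and> (\<forall>x. measure M {x} = 0)"

definition point_measure_of :: "nat \<Rightarrow> (nat \<Rightarrow> real measure) \<Rightarrow> (nat \<Rightarrow> real) measure" where
  "point_measure_of d D = PiM {1..d} D"

text \<open>
  The joint law of the sequence \<open>q 1, \<dots>, q n\<close>; \<open>q i j\<close> is the \<open>j\<close>-th coordinate of
  the \<open>i\<close>-th point. That the sampled values are pairwise distinct need not be imposed: it holds
  almost surely (lemma \<open>AE_sample_distinct\<close> below), so it does not affect any probability.
\<close>

definition sample_measure ::
    "nat \<Rightarrow> (nat \<Rightarrow> real measure) \<Rightarrow> nat \<Rightarrow> (nat \<Rightarrow> nat \<Rightarrow> real) measure" where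
  "sample_measure d D n = PiM {1..n} (\<lambda>_. point_measure_of d D)"

lemma AE_PiM_components_neq:
  fixes M :: "'i \<Rightarrow> 'a measure" and f g :: "'a \<Rightarrow> real"
  assumes prob: "\<And>i. i \<in> I \<Longrightarrow> prob_space (M i)" and fin: "finite I"
    and i: "i \<in> I" "i' \<in> I" "i \<noteq> i'"
    and f [measurable]: "f \<in> borel_measurable (M i)"
    and g [measurable]: "g \<in> borel_measurable (M i')"
    and null: "\<And>y. AE x in M i. f x \<noteq> y"
  shows "AE \<omega> in PiM I M. f (\<omega> i) \<noteq> g (\<omega> i')"
proof -
  define M' where "M' k = (if k \<in> I then M k else M i)" for k
  have eq: "PiM I M = PiM I M'" by (rule PiM_cong) (auto simp: M'_def)
  have "prob_space (M' k)" for k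
    using prob i(1) by (simp add: M'_def)
  then interpret product_prob_space M' by (rule product_prob_spaceI)
  define J where "J = I - {i}"
  have I: "I = insert i J" "i \<notin> J" "finite J" "i' \<in> J" using i fin by (auto simp: J_def)
  have fm [measurable]: "f \<in> borel_measurable (M' i)" and gm [measurable]: "g \<in> borel_measurable (M' i')"
    using i f g by (auto simp: M'_def)
  have [measurable]: "(\<lambda>\<omega>. \<omega> i) \<in> measurable (PiM I M') (M' i)" "(\<lambda>\<omega>. \<omega> i') \<in> measurable (PiM I M') (M' i')"
    using i by (auto intro: measurable_component_singleton)
  define S where "S = {\<omega> \<in> space (PiM I M'). f (\<omega> i) = g (\<omega> i')}"
  have S [measurable]: "S \<in> sets (PiM I M')" unfolding S_def by measurable
  have "emeasure (PiM I M') S = (\<integral>\<^sup>+\<omega>. indicator S \<omega> \<partial>PiM (insert i J) M')"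
    using S I by simp
  also have "\<dots> = (\<integral>\<^sup>+\<omega>. (\<integral>\<^sup>+x. indicator S (fun_upd \<omega> i x) \<partial>M' i) \<partial>PiM J M')"
    using S by (intro product_nn_integral_insert I(2,3) borel_measurable_indicator) (simp only: I(1)[symmetric])
  also have "\<dots> = (\<integral>\<^sup>+\<omega>. 0 \<partial>PiM J M')"
  proof (intro nn_integral_cong)
    fix \<omega> assume "\<omega> \<in> space (PiM J M')"
    have "AE x in M' i. f x \<noteq> g (\<omega> i')" 
      unfolding M'_def if_P[OF i(1)] by (rule null)
    then have "AE x in M' i. indicator S (fun_upd \<omega> i x) = (0::ennreal)"
      by eventually_elim (use i in \<open>auto simp: S_def indicator_def\<close>)
    then show "(\<integral>\<^sup>+x. indicator S (fun_upd \<omega> i x) \<partial>M' i) = 0"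
      using nn_integral_cong_AE[of "\<lambda>x. indicator S (fun_upd \<omega> i x)" "\<lambda>_. 0" "M' i"] by simp
  qed
  finally have "S \<in> null_sets (PiM I M')" using S by (auto simp: null_sets_def)
  then have "AE \<omega> in PiM I M'. \<omega> \<notin> S" by (rule AE_not_in)
  then have "AE \<omega> in PiM I M'. f (\<omega> i) \<noteq> g (\<omega> i')"
    by (rule AE_mp) (rule AE_I2, simp add: S_def)
  then show ?thesis unfolding eq .
qed

lemma AE_sample_distinct:
  assumes D: "\<And>j. j \<in> {1..d} \<Longrightarrow> atomless_unit_distribution (D j)"
  shows "AE q in sample_measure d D n. inj_on (\<lambda>(i, j). q i j) ({1..n} \<times> {1..d})"
proof -
  have rd: "prob_space (D j)" "sets (D j) = sets borel" if "j \<in> {1..d}" for j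
    using D[OF that] by (auto simp: atomless_unit_distribution_def real_distribution_def
      real_distribution_axioms_def)
  have id: "(\<lambda>x. x) \<in> borel_measurable (D j)" if "j \<in> {1..d}" for j
    by (rule measurable_ident_sets) (rule rd(2)[OF that])
  have atom: "AE x in D j. x \<noteq> y" if j: "j \<in> {1..d}" for j y
  proof -
    interpret prob_space "D j" by (rule rd[OF j])
    have "emeasure (D j) {y} = 0"
      using D[OF j] by (simp add: atomless_unit_distribution_def emeasure_eq_measure)
    then have "{y} \<in> null_sets (D j)" using rd[OF j] by (auto simp: null_sets_def)
    from AE_not_in[OF this] show ?thesis by simp
  qed
  let ?P = "PiM {1..d} D"
  have P: "prob_space ?P" by (rule prob_space_PiM) (rule rd)
  have comp: "(\<lambda>x. x j) \<in> borel_measurable ?P" if "j \<in> {1..d}" for j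
    using measurable_compose[OF measurable_component_singleton[OF that, of D] id[OF that]] .
  have same: "AE x in ?P. x j \<noteq> x j'" if "j \<in> {1..d}" "j' \<in> {1..d}" "j \<noteq> j'" for j j'
    by (rule AE_PiM_components_neq[where M = D and i = j and i' = j' and f = "\<lambda>x. x" and g = "\<lambda>x. x", OF rd(1) finite_atLeastAtMost
      that id[OF that(1)] id[OF that(2)] atom[OF that(1)]])
  have null: "AE x in ?P. x j \<noteq> y" if "j \<in> {1..d}" for j y
    by (rule AE_PiM_component[where M = D and i = j and P = "\<lambda>x. x \<noteq> y", OF rd(1) that atom[OF that]])
  have "AE q in PiM {1..n} (\<lambda>_. ?P). q i j \<noteq> q i' j'"
    if "(i, j) \<noteq> (i', j')" "i \<in> {1..n}" "i' \<in> {1..n}" "j \<in> {1..d}" "j' \<in> {1..d}" for i j i' j'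
  proof (cases "i = i'")
    case True
    then have "j \<noteq> j'" using that by simp
    from AE_PiM_component[where M = "\<lambda>_. ?P" and P = "\<lambda>x. x j \<noteq> x j'", OF P that(2) same[OF that(4,5) this]]
    show ?thesis using True by simp
  next
    case False
    show ?thesis
      by (rule AE_PiM_components_neq[where M = "\<lambda>_. ?P" and i = i and i' = i' and f = "\<lambda>x. x j" and g = "\<lambda>x. x j'",
        OF P finite_atLeastAtMost that(2,3) False comp[OF that(4)] comp[OF that(5)] null[OF that(4)]])
  qed
  then have "AE q in PiM {1..n} (\<lambda>_. ?P). \<forall>a \<in> {1..n} \<times> {1..d}. \<forall>b \<in> {1..n} \<times> {1..d}.
      a \<noteq> b \<longrightarrow> q (fst a) (snd a) \<noteq> q (fst b) (snd b)"
    by (intro AE_finite_allI finite_cartesian_product finite_atLeastAtMost) (auto simp: prod_eq_iff)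
  then show ?thesis
    unfolding sample_measure_def point_measure_of_def
    by (rule AE_mp) (rule AE_I2, fastforce simp: inj_on_def)
qed

end

theory Submission
  imports Defs "HOL-Combinatorics.Permutations" "HOL-Analysis.Harmonic_Numbers"
begin

text \<open>
  The law of the sample is invariant under permuting, separately in each coordinate, the values of
  the \<open>n\<close> points. So it suffices to bound, for one fixed array of values, the proportion of tuples of
  permutations (one per coordinate) that produce a large staircase. Singling out one coordinate as
  time, a point is minimal iff it is minimal, in the remaining coordinates, among the points not
  later than it. The induction on the number of coordinates bounds all these staircases of prefixes
  by \<open>L\<close> up to a small proportion; backwards analysis in time then bounds the exponential moment of
  the number of minimal points by \<open>\<Prod>\<^sub>k (1 + 2 L / k)\<close>, which costs one factor \<open>log n\<close>. The union of
  the staircases of the prefixes is the staircase with the index as an additional coordinate.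
\<close>

subsection \<open>Minimal points under random permutations of the coordinates\<close>

text \<open>Indices are collected instead of points, so that permutations can act on them. Two
  indices with equal rows exclude each other; the link with \<open>staircase\<close> is made for
  injective arrays.\<close>

definition minima :: "'i set \<Rightarrow> 'j set \<Rightarrow> ('i \<Rightarrow> 'j \<Rightarrow> real) \<Rightarrow> 'i set" where
  "minima I J x = {i \<in> I. \<not> (\<exists>k\<in>I. k \<noteq> i \<and> (\<forall>j\<in>J. x k j \<le> x i j))}"

text \<open>A right action: shuffling by \<open>\<pi>\<close> and then by \<open>\<rho>\<close> uses
  \<open>\<pi> j \<circ> \<rho> j\<close> in coordinate \<open>j\<close>.\<close>

definition shuffle :: "('i \<Rightarrow> 'j \<Rightarrow> 'a) \<Rightarrow> ('j \<Rightarrow> 'i \<Rightarrow> 'i) \<Rightarrow> 'i \<Rightarrow> 'j \<Rightarrow> 'a" where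
  "shuffle x \<pi> = (\<lambda>i j. x (\<pi> j i) j)"

text \<open>\<open>PiE\<close> fixes the tuples outside \<open>J\<close>, so that they can be
  counted and averaged over.\<close>

definition perms :: "'j set \<Rightarrow> 'i set \<Rightarrow> ('j \<Rightarrow> 'i \<Rightarrow> 'i) set" where
  "perms J I = PiE J (\<lambda>_. {p. p permutes I})"

lemma minima_subset: "minima I J x \<subseteq> I"
  by (auto simp: minima_def)

lemma minima_cong:
  assumes "\<And>i j. i \<in> I \<Longrightarrow> j \<in> J \<Longrightarrow> x i j = y i j"
  shows "minima I J x = minima I J y"
  using assms by (auto simp: minima_def)

text \<open>Whatever excludes \<open>i\<close> must also be at most \<open>x i j\<close> in
  coordinate \<open>j\<close>. So \<open>j\<close> can be read as time, and only the prefix ending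
  at \<open>i\<close> matters.\<close>

lemma minima_insert:
  "minima I (insert j J) x = {i \<in> I. i \<in> minima {k \<in> I. x k j \<le> x i j} J x}"
  by (auto simp: minima_def)

text \<open>Base of the induction on coordinates: any two reals are comparable, so of two indices at
  least one is excluded.\<close>

lemma card_minima_singleton_le: "card (minima I {j} x) \<le> 1"
proof -
  have "a = b" if "a \<in> minima I {j} x" "b \<in> minima I {j} x" for a b
    using that linear[of "x a j" "x b j"] by (auto simp: minima_def)
  then show ?thesis
    by (simp add: card_le_Suc0_iff_eq card.infinite le_Suc_eq) (metis card.infinite card_le_Suc0_iff_eq le_Suc_eq le_zero_eq)
qed

section \<open>Averages over tuples of permutations\<close>

lemma card_perms: "finite J \<Longrightarrow> finite I \<Longrightarrow> card (perms J I) = fact (card I) ^ card J"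
  by (simp add: perms_def card_PiE card_permutations[OF refl])

lemma permsD: "\<pi> \<in> perms J I \<Longrightarrow> j \<in> J \<Longrightarrow> \<pi> j permutes I"
  by (auto simp: perms_def)

text \<open>Fubini for independent permutations; it separates the time coordinate from the
  others.\<close>

lemma sum_perms_insert:
  fixes f :: "('j \<Rightarrow> 'i \<Rightarrow> 'i) \<Rightarrow> real"
  assumes "j \<notin> J"
  shows "(\<Sum>\<pi>\<in>perms (insert j J) I. f \<pi>) = (\<Sum>p | p permutes I. \<Sum>\<pi>\<in>perms J I. f (\<pi>(j := p)))"
  unfolding perms_def PiE_insert_eq sum.cartesian_product
  by (subst sum.reindex[OF inj_combinator[OF assms]]) (simp add: comp_def case_prod_unfold)

text \<open>Right translation by \<open>\<rho>\<close> is a bijection of the product of symmetric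
  groups; its inverse is translation by the inverses.\<close>

lemma sum_perms_compose:
  fixes f :: "('j \<Rightarrow> 'i \<Rightarrow> 'i) \<Rightarrow> real"
  assumes "\<rho> \<in> perms J I"
  shows "(\<Sum>\<pi>\<in>perms J I. f \<pi>) = (\<Sum>\<pi>\<in>perms J I. f (\<lambda>j\<in>J. \<pi> j \<circ> \<rho> j))"
proof (rule sum.reindex_bij_witness[where j = "\<lambda>\<pi>. \<lambda>j\<in>J. \<pi> j \<circ> inv (\<rho> j)" and i = "\<lambda>\<pi>. \<lambda>j\<in>J. \<pi> j \<circ> \<rho> j"])
  fix \<pi> assume \<pi>: "\<pi> \<in> perms J I"
  have inv: "\<rho> j \<circ> inv (\<rho> j) = id" "inv (\<rho> j) \<circ> \<rho> j = id" if "j \<in> J" for j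
    using permutes_inv_o[OF permsD[OF assms that]] by auto
  have undef: "\<pi> j = undefined" if "j \<notin> J" for j
    using \<pi> that by (auto simp: perms_def)
  show eq: "(\<lambda>j\<in>J. (\<lambda>j\<in>J. \<pi> j \<circ> inv (\<rho> j)) j \<circ> \<rho> j) = \<pi>"
    by (rule ext) (simp add: undef comp_assoc inv)
  show "(\<lambda>j\<in>J. (\<lambda>j\<in>J. \<pi> j \<circ> \<rho> j) j \<circ> inv (\<rho> j)) = \<pi>"
    by (rule ext) (simp add: undef comp_assoc inv)
  show "(\<lambda>j\<in>J. \<pi> j \<circ> inv (\<rho> j)) \<in> perms J I" "(\<lambda>j\<in>J. \<pi> j \<circ> \<rho> j) \<in> perms J I"
    using \<pi> assms unfolding perms_def by (auto intro!: permutes_compose permutes_inv)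
  show "f (\<lambda>j\<in>J. (\<lambda>j\<in>J. \<pi> j \<circ> inv (\<rho> j)) j \<circ> \<rho> j) = f \<pi>"
    unfolding eq ..
qed

text \<open>
  Backwards analysis: conditionally on the set \<open>K\<close> of the first \<open>k\<close> elements, the last of them is
  uniform on \<open>K\<close>, hence lies in \<open>S K\<close> with probability at most \<open>L / k\<close>, whatever the order of
  the earlier elements.
\<close>

lemma sum_exp_card_records_le:
  fixes y :: "'i \<Rightarrow> real" and S :: "'i set \<Rightarrow> 'i set" and L :: real
  assumes "finite I" "inj_on y I" "\<And>K. S K \<subseteq> K" "\<And>K. finite K \<Longrightarrow> card (S K) \<le> L"
  shows "(\<Sum>p | p permutes I. exp (real (card {i\<in>I. i \<in> S {k\<in>I. y (p k) \<le> y (p i)}})))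
    \<le> (\<Prod>k=1..card I. real k + 2 * L)"
  using assms
\<comment> \<open>Elements enter in increasing order of \<open>y\<close>, so the new element
  \<open>a\<close> has the largest value. \<open>S\<close> stays arbitrary because the hypothesis is
  applied to a conjugate of it.\<close>
proof (induction I arbitrary: S rule: finite_ranking_induct[where f = y])
  case (insert a I)
  show ?case
  proof (cases "a \<in> I")
    case True
    then show ?thesis using insert by (simp add: insert_absorb)
  next
    case a: False
    have L: "L \<ge> 0" using insert.prems(3)[of "{}"] insert.prems(2)[of "{}"] by simp
    have less: "y i < y a" if i: "i \<in> I" for i
    proof -
      have "i \<noteq> a" using i a by blast
      then have "y i \<noteq> y a" using inj_onD[OF insert.prems(1), of i a] i by blast
      then show ?thesis using insert.hyps(2)[OF i] by simp
    qed
    define N where "N p = card {i\<in>insert a I. i \<in> S {k\<in>insert a I. y (p k) \<le> y (p i)}}" for p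
    \<comment> \<open>Every permutation of \<open>insert a I\<close> is
      \<open>q \<circ> \<tau> b\<close> with \<open>q\<close> fixing \<open>a\<close>. It sends
      \<open>b\<close> to \<open>a\<close>, so \<open>b\<close> is the last element in time; the
      swap renames it to \<open>a\<close> and leaves a problem on \<open>I\<close> with
      \<open>S\<close> conjugated.\<close>
    define \<tau> where "\<tau> b = Transposition.transpose a b" for b
    define S' where "S' b K = \<tau> b ` S (\<tau> b ` K)" for b K
    have \<tau>\<tau>: "\<tau> b (\<tau> b i) = i" for b i by (simp add: \<tau>_def)
    have inj\<tau>: "inj (\<tau> b)" for b by (metis \<tau>\<tau> injI)
    have \<tau>I: "\<tau> b ` insert a I = insert a I" if "b \<in> insert a I" for b
      unfolding \<tau>_def using that by (intro permutes_image permutes_swap_id) auto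
    \<comment> \<open>The last element has the whole set as its prefix and contributes one
      indicator. The prefixes of all other elements avoid it.\<close>
    have *: "N (q \<circ> \<tau> b) = of_bool (b \<in> S (insert a I))
        + card {i\<in>I. i \<in> S' b {k\<in>I. y (q k) \<le> y (q i)}}"
      if b: "b \<in> insert a I" and q: "q permutes I" for b q
    proof -
      have qa: "q a = a" and qI: "\<And>i. i \<in> I \<Longrightarrow> q i \<in> I"
        using q a by (auto simp: permutes_in_image permutes_not_in)
      have img: "{k\<in>insert a I. P (\<tau> b k)} = \<tau> b ` {k\<in>insert a I. P k}" for P
      proof (intro set_eqI iffI)
        fix k assume k: "k \<in> {k\<in>insert a I. P (\<tau> b k)}"
        then have "\<tau> b k \<in> \<tau> b ` insert a I" by blast
        with k have "\<tau> b k \<in> {k\<in>insert a I. P k}" unfolding \<tau>I[OF b] by blast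
        then show "k \<in> \<tau> b ` {k\<in>insert a I. P k}" by (rule rev_image_eqI) (simp add: \<tau>\<tau>)
      next
        fix k assume "k \<in> \<tau> b ` {k\<in>insert a I. P k}"
        then obtain l where l: "l \<in> insert a I" "P l" "k = \<tau> b l" by blast
        then have "k \<in> \<tau> b ` insert a I" by blast
        with l show "k \<in> {k\<in>insert a I. P (\<tau> b k)}" unfolding \<tau>I[OF b] by (simp add: \<tau>\<tau>)
      qed
      have set_eq: "{k\<in>insert a I. y (q (\<tau> b k)) \<le> y (q i)} = \<tau> b ` {k\<in>insert a I. y (q k) \<le> y (q i)}" for i
        by (rule img)
      have "{i\<in>insert a I. i \<in> S {k\<in>insert a I. y ((q \<circ> \<tau> b) k) \<le> y ((q \<circ> \<tau> b) i)}}
        = \<tau> b ` {i\<in>insert a I. \<tau> b i \<in> S {k\<in>insert a I. y (q (\<tau> b k)) \<le> y (q i)}}" (is "_ = _ ` ?R")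
        by (subst img[symmetric]) (simp add: \<tau>\<tau>)
      then have "N (q \<circ> \<tau> b) = card ?R"
        unfolding N_def by (simp add: card_image inj_on_subset[OF inj\<tau>])
      also have "?R = {i\<in>insert a I. \<tau> b i \<in> S (\<tau> b ` {k\<in>insert a I. y (q k) \<le> y (q i)})}"
        unfolding set_eq ..
      also have "\<dots> = (if b \<in> S (insert a I) then {a} else {}) \<union> {i\<in>I. i \<in> S' b {k\<in>I. y (q k) \<le> y (q i)}}"
      proof -
        have 1: "{k\<in>insert a I. y (q k) \<le> y (q a)} = insert a I"
          using less qI qa by (auto intro: less_imp_le)
        have 2: "{k\<in>insert a I. y (q k) \<le> y (q i)} = {k\<in>I. y (q k) \<le> y (q i)}" if "i \<in> I" for i
          using less[OF qI[OF that]] qa by auto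
        have 3: "\<tau> b i \<in> S (\<tau> b ` K) \<longleftrightarrow> i \<in> S' b K" for i K
          unfolding S'_def by (metis \<tau>\<tau> image_iff)
        have 4: "\<tau> b a = b" by (simp add: \<tau>_def)
        have 5: "\<tau> b a \<in> S (\<tau> b ` insert a I) \<longleftrightarrow> b \<in> S (insert a I)"
          unfolding 4 \<tau>I[OF b] ..
        show ?thesis
        proof (intro set_eqI)
          fix i
          show "i \<in> {i\<in>insert a I. \<tau> b i \<in> S (\<tau> b ` {k\<in>insert a I. y (q k) \<le> y (q i)})} \<longleftrightarrow>
            i \<in> (if b \<in> S (insert a I) then {a} else {}) \<union> {i\<in>I. i \<in> S' b {k\<in>I. y (q k) \<le> y (q i)}}"
          proof (cases "i = a")
            case True
            show ?thesis unfolding True mem_Collect_eq 1 5 using a by simp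
          next
            case False
            then have "?thesis \<longleftrightarrow> (i \<in> I \<and> \<tau> b i \<in> S (\<tau> b ` {k\<in>insert a I. y (q k) \<le> y (q i)})
                \<longleftrightarrow> i \<in> I \<and> i \<in> S' b {k\<in>I. y (q k) \<le> y (q i)})" by simp
            then show ?thesis using 2[of i] 3[of i] by (cases "i \<in> I") simp_all
          qed
        qed
      qed
      also have "card \<dots> = of_bool (b \<in> S (insert a I)) + card {i\<in>I. i \<in> S' b {k\<in>I. y (q k) \<le> y (q i)}}"
        using a insert.hyps(1) by (subst card_Un_disjoint) auto
      finally show ?thesis .
    qed
    have IH: "(\<Sum>q | q permutes I. exp (real (card {i\<in>I. i \<in> S' b {k\<in>I. y (q k) \<le> y (q i)}})))
        \<le> (\<Prod>k=1..card I. real k + 2 * L)" for b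
    proof (rule insert.IH)
      show "inj_on y I" using insert.prems(1) by auto
      show "S' b K \<subseteq> K" for K
        using insert.prems(2)[of "\<tau> b ` K"] \<tau>\<tau> unfolding S'_def by auto
      show "real (card (S' b K)) \<le> L" if "finite K" for K
        using insert.prems(3)[of "\<tau> b ` K"] that unfolding S'_def 
        by (simp add: card_image inj_on_subset[OF inj\<tau>])
    qed
    have P: "(\<Prod>k=1..card I. real k + 2 * L) \<ge> 0" using L by (intro prod_nonneg) auto
    \<comment> \<open>\<open>sum_over_permutations_insert\<close> composes with the transposition on
      the left; inverting before and after moves it to the right.\<close>
    have "(\<Sum>p | p permutes insert a I. exp (real (N p))) = (\<Sum>p | p permutes insert a I. exp (real (N (inv p))))"
      by (rule sum_permutations_inverse)
    also have "\<dots> = (\<Sum>b\<in>insert a I. \<Sum>q | q permutes I. exp (real (N (inv (\<tau> b \<circ> q)))))"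
      unfolding sum_over_permutations_insert[OF insert.hyps(1) a] \<tau>_def ..
    also have "\<dots> = (\<Sum>b\<in>insert a I. \<Sum>q | q permutes I. exp (real (N (inv q \<circ> \<tau> b))))"
      by (intro sum.cong refl) (simp add: \<tau>_def o_inv_distrib permutes_bij)
    also have "\<dots> = (\<Sum>b\<in>insert a I. \<Sum>q | q permutes I. exp (real (N (q \<circ> \<tau> b))))"
      by (subst (2) sum_permutations_inverse) simp
    also have "\<dots> = (\<Sum>b\<in>insert a I. exp (of_bool (b \<in> S (insert a I))) *
        (\<Sum>q | q permutes I. exp (real (card {i\<in>I. i \<in> S' b {k\<in>I. y (q k) \<le> y (q i)}}))))"
      by (simp add: * exp_add sum_distrib_left)
    also have "\<dots> \<le> (\<Sum>b\<in>insert a I. exp (of_bool (b \<in> S (insert a I))) * (\<Prod>k=1..card I. real k + 2 * L))"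
      by (intro sum_mono mult_left_mono IH) auto
    \<comment> \<open>Origin of the factor 2: \<open>exp 1 \<le> 3\<close>, so the exponential of an
      indicator is at most 1 plus twice the indicator.\<close>
    also have "\<dots> \<le> (\<Sum>b\<in>insert a I. 1 + 2 * of_bool (b \<in> S (insert a I))) * (\<Prod>k=1..card I. real k + 2 * L)"
      unfolding sum_distrib_right
      using exp_le by (intro sum_mono mult_right_mono P) auto
    also have "\<dots> = (real (card (insert a I)) + 2 * card (S (insert a I))) * (\<Prod>k=1..card I. real k + 2 * L)"
      using insert.hyps(1) insert.prems(2)[of "insert a I"]
      by (simp add: sum.distrib sum_distrib_left[symmetric] Int_absorb1 Int_commute Collect_mem_eq)
    also have "\<dots> \<le> (real (card (insert a I)) + 2 * L) * (\<Prod>k=1..card I. real k + 2 * L)"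
      using insert.prems(3)[of "insert a I"] insert.hyps(1) by (intro mult_right_mono P) auto
    also have "\<dots> = (\<Prod>k=1..card (insert a I). real k + 2 * L)"
      using insert.hyps(1) a by (simp add: mult.commute)
    finally show ?thesis unfolding N_def .
  qed
qed simp

text \<open>Composing a uniform tuple on \<open>I\<close> with a tuple on \<open>K\<close> does not
  change its law. Averaging over the latter as well, the inner average for fixed
  \<open>\<pi>\<close> is the hypothesis for the array \<open>shuffle x \<pi>\<close>, which is
  still injective on \<open>K\<close>.\<close>

lemma sum_card_minima_gt_subset_le:
  fixes x :: "'i \<Rightarrow> 'j \<Rightarrow> real" and c L :: real
  assumes fin: "finite J" "finite I" and K: "K \<subseteq> I" and inj: "\<And>j. j \<in> J \<Longrightarrow> inj_on (\<lambda>i. x i j) I"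
    and H: "\<And>x'. (\<And>j. j \<in> J \<Longrightarrow> inj_on (\<lambda>i. x' i j) K) \<Longrightarrow>
      (\<Sum>\<rho>\<in>perms J K. of_bool (L < real (card (minima K J (shuffle x' \<rho>))))) \<le> c * real (card (perms J K))"
  shows "(\<Sum>\<pi>\<in>perms J I. of_bool (L < real (card (minima K J (shuffle x \<pi>))))) \<le> c * real (card (perms J I))"
proof -
  define h :: "('i \<Rightarrow> 'j \<Rightarrow> real) \<Rightarrow> real" where "h z = of_bool (L < real (card (minima K J z)))" for z
  have h_cong: "h (shuffle x (\<lambda>j\<in>J. \<pi> j \<circ> \<rho> j)) = h (shuffle (shuffle x \<pi>) \<rho>)" for \<pi> \<rho>
    unfolding h_def by (subst minima_cong[where y = "shuffle (shuffle x \<pi>) \<rho>"]) (auto simp: shuffle_def)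
  have inj': "inj_on (\<lambda>i. shuffle x \<pi> i j) K" if "\<pi> \<in> perms J I" "j \<in> J" for \<pi> j
  proof -
    have p: "\<pi> j permutes I" using that by (rule permsD)
    then have "inj_on (\<pi> j) K" by (meson permutes_inj inj_on_subset subset_UNIV)
    moreover have "\<pi> j ` K \<subseteq> I" using permutes_in_image[OF p] K by auto
    ultimately show ?thesis
      using comp_inj_on[of "\<pi> j" K "\<lambda>i. x i j"] inj_on_subset[OF inj[OF that(2)]]
      by (simp add: shuffle_def comp_def)
  qed
  have pos: "real (card (perms J K)) > 0"
    using fin finite_subset[OF K] by (simp add: card_perms)
  have "real (card (perms J K)) * (\<Sum>\<pi>\<in>perms J I. h (shuffle x \<pi>))
      = (\<Sum>\<rho>\<in>perms J K. \<Sum>\<pi>\<in>perms J I. h (shuffle x \<pi>))"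
    by simp
  also have "\<dots> = (\<Sum>\<rho>\<in>perms J K. \<Sum>\<pi>\<in>perms J I. h (shuffle x (\<lambda>j\<in>J. \<pi> j \<circ> \<rho> j)))"
  proof (rule sum.cong[OF refl], rule sum_perms_compose)
    fix \<rho> assume "\<rho> \<in> perms J K"
    then show "\<rho> \<in> perms J I"
      using permutes_subset[OF _ K] unfolding perms_def by (auto simp: PiE_iff)
  qed
  also have "\<dots> = (\<Sum>\<pi>\<in>perms J I. \<Sum>\<rho>\<in>perms J K. h (shuffle (shuffle x \<pi>) \<rho>))"
    unfolding h_cong by (rule sum.swap)
  also have "\<dots> \<le> (\<Sum>\<pi>\<in>perms J I. c * real (card (perms J K)))"
    unfolding h_def by (intro sum_mono H inj')
  also have "\<dots> = real (card (perms J K)) * (c * real (card (perms J I)))"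
    by simp
  finally show ?thesis using pos unfolding h_def by simp
qed

text \<open>Induction step. A union bound over the \<open>card I\<close> prefixes costs
  \<open>\<epsilon>\<close> each; otherwise Markov's inequality applies to the exponential moment
  from \<open>sum_exp_card_records_le\<close>. Dividing by the factorial turns
  \<open>k + 2 * L\<close> into \<open>1 + 2 * L / k\<close>.\<close>

lemma sum_card_minima_gt_insert_le:
  fixes x :: "'i \<Rightarrow> 'j \<Rightarrow> real" and \<epsilon> L t :: real
  assumes fin: "finite J" "finite I" and j: "j \<notin> J" and L: "L \<ge> 0"
    and inj: "\<And>j'. j' \<in> insert j J \<Longrightarrow> inj_on (\<lambda>i. x i j') I"
    and H: "\<And>K x'. K \<subseteq> I \<Longrightarrow> (\<And>j. j \<in> J \<Longrightarrow> inj_on (\<lambda>i. x' i j) K) \<Longrightarrow>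
      (\<Sum>\<rho>\<in>perms J K. of_bool (L < real (card (minima K J (shuffle x' \<rho>))))) \<le> \<epsilon> * real (card (perms J K))"
  shows "(\<Sum>\<pi>\<in>perms (insert j J) I. of_bool (t < real (card (minima I (insert j J) (shuffle x \<pi>)))))
    \<le> (real (card I) * \<epsilon> + exp (- t) * (\<Prod>k=1..card I. 1 + 2 * L / real k)) * real (card (perms (insert j J) I))"
proof -
  define A where "A p i = {k\<in>I. x (p k) j \<le> x (p i) j}" for p i
  \<comment> \<open>Truncation makes the cardinality bound of the backwards analysis hold for every
    \<open>K\<close>. If no prefix exceeds \<open>L\<close>, nothing is changed on the
    prefixes.\<close>
  define S where "S \<pi> K = (if real (card (minima K J (shuffle x \<pi>))) \<le> L then minima K J (shuffle x \<pi>) else {})" for \<pi> K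
  have eq: "minima I (insert j J) (shuffle x (\<pi>(j := p))) = {i\<in>I. i \<in> minima (A p i) J (shuffle x \<pi>)}" for \<pi> p
  proof -
    have "minima K J (shuffle x (\<pi>(j := p))) = minima K J (shuffle x \<pi>)" for K
      using j by (intro minima_cong) (auto simp: shuffle_def)
    then show ?thesis by (simp add: minima_insert shuffle_def A_def)
  qed
  have le: "of_bool (t < real (card (minima I (insert j J) (shuffle x (\<pi>(j := p))))))
      \<le> (\<Sum>i\<in>I. of_bool (L < real (card (minima (A p i) J (shuffle x \<pi>)))))
        + exp (- t) * exp (real (card {i\<in>I. i \<in> S \<pi> (A p i)}))" (is "?l \<le> ?s + ?e") for \<pi> p
  proof (cases "\<exists>i\<in>I. L < real (card (minima (A p i) J (shuffle x \<pi>)))")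
    case True
    then obtain i where i: "i \<in> I" "L < real (card (minima (A p i) J (shuffle x \<pi>)))" by blast
    have "(1::real) = of_bool (L < real (card (minima (A p i) J (shuffle x \<pi>))))" using i by simp
    also have "\<dots> \<le> ?s" using fin i(1) by (intro member_le_sum) auto
    finally have "1 \<le> ?s" .
    moreover have "?l \<le> 1" "0 \<le> ?e" by auto
    ultimately show ?thesis by linarith
  next
    case False
    then have "{i\<in>I. i \<in> S \<pi> (A p i)} = {i\<in>I. i \<in> minima (A p i) J (shuffle x \<pi>)}"
      by (force simp: S_def)
    then have "?e = exp (real (card (minima I (insert j J) (shuffle x (\<pi>(j := p))))) - t)"
      by (simp add: eq exp_diff exp_minus field_simps)
    moreover have "?s \<ge> 0" by (intro sum_nonneg) auto
    moreover have "?l \<le> exp (real (card (minima I (insert j J) (shuffle x (\<pi>(j := p))))) - t)"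
      by (simp add: of_bool_def)
    ultimately show ?thesis by linarith
  qed
  have "(\<Sum>\<pi>\<in>perms (insert j J) I. of_bool (t < real (card (minima I (insert j J) (shuffle x \<pi>)))))
     \<le> (\<Sum>p | p permutes I. \<Sum>\<pi>\<in>perms J I. (\<Sum>i\<in>I. of_bool (L < real (card (minima (A p i) J (shuffle x \<pi>)))))
        + exp (- t) * exp (real (card {i\<in>I. i \<in> S \<pi> (A p i)})))"
    unfolding sum_perms_insert[OF j] by (intro sum_mono le)
  \<comment> \<open>The first term is averaged over \<open>\<pi>\<close> with the time order
    \<open>p\<close>, hence the prefixes, fixed; the second over \<open>p\<close> with
    \<open>\<pi>\<close> fixed.\<close>
  also have "\<dots> = (\<Sum>p | p permutes I. \<Sum>i\<in>I. \<Sum>\<pi>\<in>perms J I. of_bool (L < real (card (minima (A p i) J (shuffle x \<pi>)))))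
      + exp (- t) * (\<Sum>\<pi>\<in>perms J I. \<Sum>p | p permutes I. exp (real (card {i\<in>I. i \<in> S \<pi> (A p i)})))"
    unfolding sum.distrib sum_distrib_left[symmetric]
    by (intro arg_cong2[where f = "(+)"] arg_cong2[where f = "(*)"] sum.cong refl sum.swap)
  also have "\<dots> \<le> (\<Sum>p | p permutes I. \<Sum>i\<in>I. \<epsilon> * real (card (perms J I)))
      + exp (- t) * (\<Sum>\<pi>\<in>perms J I. \<Prod>k=1..card I. real k + 2 * L)"
  proof (intro add_mono sum_mono mult_left_mono)
    fix p i
    have sub: "A p i \<subseteq> I" by (auto simp: A_def)
    show "(\<Sum>\<pi>\<in>perms J I. of_bool (L < real (card (minima (A p i) J (shuffle x \<pi>))))) \<le> \<epsilon> * real (card (perms J I))"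
    proof (rule sum_card_minima_gt_subset_le[OF fin])
      show "A p i \<subseteq> I" by (rule sub)
      show "inj_on (\<lambda>i. x i j') I" if "j' \<in> J" for j' using that by (intro inj) simp
    qed (rule H[OF sub])
  next
    fix \<pi>
    show "(\<Sum>p | p permutes I. exp (real (card {i\<in>I. i \<in> S \<pi> (A p i)}))) \<le> (\<Prod>k=1..card I. real k + 2 * L)"
      unfolding A_def
    proof (rule sum_exp_card_records_le[OF fin(2) inj])
      show "S \<pi> K \<subseteq> K" for K by (simp add: S_def minima_subset)
      show "real (card (S \<pi> K)) \<le> L" for K using L by (simp add: S_def)
    qed simp
  qed simp
  also have "(\<Prod>k=1..card I. real k + 2 * L) = fact (card I) * (\<Prod>k=1..card I. 1 + 2 * L / real k)"
    unfolding fact_prod of_nat_prod prod.distrib[symmetric] by (intro prod.cong) (auto simp: field_simps)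
  finally show ?thesis
    using fin j by (simp add: card_perms card_permutations[OF refl] algebra_simps)
qed

section \<open>Harmonic sums and the induction on the number of coordinates\<close>

lemma prod_one_plus_inverse_le:
  fixes a :: real
  assumes a: "a \<ge> 0" and n: "m \<le> n" "n > 0"
  shows "(\<Prod>k=1..m. 1 + a / real k) \<le> exp (a * (1 + ln (real n)))"
proof (cases "m = 0")
  case True
  then show ?thesis using assms by simp
next
  case False
  have "(\<Prod>k=1..m. 1 + a / real k) \<le> (\<Prod>k=1..m. exp (a / real k))"
    using a by (intro prod_mono) (auto intro: exp_ge_add_one_self)
  also have "\<dots> = exp (a * harm m)"
    by (simp add: exp_sum[symmetric] harm_def sum_distrib_left divide_inverse)
  \<comment> \<open>The sequence \<open>harm m - ln m\<close> is decreasing and equals 1 at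
    \<open>m = 1\<close>.\<close>
  also have "harm m \<le> 1 + ln (real m)"
    using euler_mascheroni_sequence_decreasing[of 1 m] False by (simp add: harm_def)
  also have "\<dots> \<le> 1 + ln (real n)" using False n by simp
  finally show ?thesis using a by (simp add: mult_left_mono)
qed

text \<open>Validity for all large \<open>C\<close> lets several coordinate sets share one constant.
  The bound \<open>card I \<le> n\<close> instead of equality keeps \<open>n\<close> fixed while the
  induction passes to prefixes, and \<open>\<gamma>\<close> varies because each step loses powers of
  \<open>n\<close>.\<close>

lemma minima_tail:
  fixes \<gamma> :: real
  assumes "finite J" "J \<noteq> {}" "\<gamma> > 0"
  shows "\<forall>\<^sub>F C in at_top. \<forall>n\<ge>2. \<forall>(I :: 'i set) x. finite I \<longrightarrow> card I \<le> n \<longrightarrow> (\<forall>j\<in>J. inj_on (\<lambda>i. x i j) I) \<longrightarrow>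
    (\<Sum>\<pi>\<in>perms J I. of_bool (C * ln (real n) ^ (card J - 1) < real (card (minima I J (shuffle x \<pi>)))))
      \<le> real n powr (- \<gamma>) * real (card (perms J I))"
  using assms
proof (induction J arbitrary: \<gamma> rule: finite_ne_induct)
  case (singleton j)
  have "\<not> 1 < real (card (minima I {j} x))" for I :: "'i set" and x
    using card_minima_singleton_le[of I j x] by simp
  then have bad: "\<not> C < real (card (minima I {j} x))" if "C \<ge> 1" for C and I :: "'i set" and x
    using that by (meson le_less_trans)
  show ?case
    using eventually_ge_at_top[of 1] by eventually_elim (simp add: bad)
next
  case (insert j J)
  define N where "N = card J"
  have N: "N > 0" using insert.hyps by (auto simp: N_def card_gt_0_iff)
  \<comment> \<open>Of the two extra powers of \<open>n\<close>, one pays for the union bound over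
    at most \<open>n\<close> prefixes, the other for adding two error terms.\<close>
  obtain C where C: "C \<ge> 0" "\<And>n (I :: 'i set) x. n \<ge> 2 \<Longrightarrow> finite I \<Longrightarrow> card I \<le> n \<Longrightarrow> (\<And>j. j\<in>J \<Longrightarrow> inj_on (\<lambda>i. x i j) I) \<Longrightarrow>
    (\<Sum>\<pi>\<in>perms J I. of_bool (C * ln (real n) ^ (N - 1) < real (card (minima I J (shuffle x \<pi>)))))
      \<le> real n powr (- (\<gamma> + 2)) * real (card (perms J I))"
    using eventually_happens'[OF _ eventually_conj[OF eventually_ge_at_top[of 0] insert.IH[of "\<gamma> + 2"]]] insert.prems
    unfolding N_def by auto
  \<comment> \<open>With \<open>l = ln n\<close>, \<open>n \<ge> 2\<close> gives
    \<open>1 \<le> 2 * l\<close>. Hence \<open>1 + l \<le> 3 * l\<close>, so \<open>6 * C\<close>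
    covers the exponent \<open>2 * L * (1 + l)\<close> of the moment bound; and
    \<open>l \<le> 2 ^ N * l ^ N\<close>, so the second summand leaves
    \<open>n powr (- (\<gamma> + 1))\<close>.\<close>
  define C' where "C' = 6 * C + (\<gamma> + 1) * 2 ^ N"
  have "(\<Sum>\<pi>\<in>perms (insert j J) I. of_bool (C'' * ln (real n) ^ N < real (card (minima I (insert j J) (shuffle x \<pi>)))))
      \<le> real n powr (- \<gamma>) * real (card (perms (insert j J) I))"
    if C'': "C'' \<ge> C'" and n: "n \<ge> 2" and I: "finite I" "card I \<le> n"
      and inj: "\<And>j'. j' \<in> insert j J \<Longrightarrow> inj_on (\<lambda>i. x i j') I"
    for C'' n and I :: "'i set" and x
  proof -
    define l where "l = ln (real n)"
    define L where "L = C * l ^ (N - 1)"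
    define t where "t = C'' * l ^ N"
    have "ln 2 \<le> l" using n by (simp add: l_def)
    then have l: "1 \<le> 2 * l" using ln2_ge_two_thirds by simp
    have L0: "L \<ge> 0" using C(1) l by (simp add: L_def)
    have lN: "l * l ^ (N - 1) = l ^ N" using N by (simp add: power_eq_if)
    have "(2 * l) ^ 1 \<le> (2 * l) ^ N" using l N by (intro power_increasing) auto
    then have "l \<le> 2 ^ N * l ^ N" using l by (simp add: power_mult_distrib)
    then have 1: "(\<gamma> + 1) * l \<le> (\<gamma> + 1) * 2 ^ N * l ^ N"
      using insert.prems by (simp add: mult.assoc mult_left_mono)
    have "2 * L * (1 + l) \<le> 2 * L * (3 * l)" using L0 l by (intro mult_left_mono) auto
    also have "\<dots> = 6 * C * l ^ N" by (simp add: L_def lN[symmetric])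
    finally have "2 * L * (1 + l) + (\<gamma> + 1) * l \<le> C' * l ^ N"
      using 1 by (simp add: C'_def algebra_simps)
    also have "\<dots> \<le> t" unfolding t_def using C'' l by (intro mult_right_mono) auto
    finally have t: "2 * L * (1 + l) + (\<gamma> + 1) * l \<le> t" .
    have "(\<Sum>\<pi>\<in>perms (insert j J) I. of_bool (t < real (card (minima I (insert j J) (shuffle x \<pi>)))))
      \<le> (real (card I) * real n powr (- (\<gamma> + 2)) + exp (- t) * (\<Prod>k=1..card I. 1 + 2 * L / real k))
        * real (card (perms (insert j J) I))"
    proof (rule sum_card_minima_gt_insert_le[OF insert.hyps(1) I(1) insert.hyps(3) L0 inj])
      fix K and x' :: "'i \<Rightarrow> 'a \<Rightarrow> real" assume K: "K \<subseteq> I" and "\<And>j. j \<in> J \<Longrightarrow> inj_on (\<lambda>i. x' i j) K"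
      moreover have "finite K" "card K \<le> n"
        using K I card_mono[of I K] finite_subset by auto
      ultimately show "(\<Sum>\<rho>\<in>perms J K. of_bool (L < real (card (minima K J (shuffle x' \<rho>)))))
          \<le> real n powr (- (\<gamma> + 2)) * real (card (perms J K))"
        unfolding L_def l_def using n by (intro C(2))
    qed
    also have "real (card I) * real n powr (- (\<gamma> + 2)) + exp (- t) * (\<Prod>k=1..card I. 1 + 2 * L / real k) \<le> real n powr (- \<gamma>)"
    proof -
      have P: "real n powr (- (\<gamma> + 1)) = exp (- ((\<gamma> + 1) * l))"
        using n by (simp add: powr_def l_def algebra_simps)
      have exponent: "1 + - (\<gamma> + 2) = - (\<gamma> + 1)" "1 + - (\<gamma> + 1) = - \<gamma>" by simp_all
      have "real (card I) * real n powr (- (\<gamma> + 2)) \<le> real n * real n powr (- (\<gamma> + 2))"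
        using I by (intro mult_right_mono) auto
      also have "\<dots> = real n powr (1 + - (\<gamma> + 2))" using n by (simp only: powr_add) simp
      finally have 2: "real (card I) * real n powr (- (\<gamma> + 2)) \<le> real n powr (- (\<gamma> + 1))"
        by (simp only: exponent)
      have "exp (- t) * (\<Prod>k=1..card I. 1 + 2 * L / real k) \<le> exp (- t) * exp (2 * L * (1 + l))"
        unfolding l_def using prod_one_plus_inverse_le[of "2 * L" "card I" n] L0 I n
        by (intro mult_left_mono) auto
      also have "\<dots> \<le> real n powr (- (\<gamma> + 1))"
        unfolding P exp_add[symmetric] using t by simp
      finally have 3: "exp (- t) * (\<Prod>k=1..card I. 1 + 2 * L / real k) \<le> real n powr (- (\<gamma> + 1))" .
      \<comment> \<open>The factor 2 from the two error terms is absorbed by one power of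
        \<open>n\<close>.\<close>
      have "2 * real n powr (- (\<gamma> + 1)) \<le> real n * real n powr (- (\<gamma> + 1))"
        using n by (intro mult_right_mono) auto
      also have "\<dots> = real n powr (1 + - (\<gamma> + 1))" using n by (simp only: powr_add) simp
      finally show ?thesis using 2 3 unfolding exponent by linarith
    qed
    finally show ?thesis unfolding t_def l_def by (simp add: mult_right_mono)
  qed
  note step = this
  have N_eq: "card (insert j J) - 1 = N" using insert.hyps by (simp add: N_def)
  show ?case
    unfolding N_eq by (rule eventually_mono[OF eventually_ge_at_top[of C']]) (intro allI impI step; blast)
qed

subsection \<open>Symmetry of the product measure\<close>

text \<open>A shuffle mixes coordinates of different points, so it respects boxes in all coordinates
  \<open>(i, j)\<close>, but not products of arbitrary sets of points. Uniqueness of the law is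
  therefore tested on these boxes.\<close>

lemma sets_PiM_PiM_eq_sigma_sets:
  assumes "finite I" "finite J"
  shows "sets (PiM I (\<lambda>_. PiM J D)) = sigma_sets (space (PiM I (\<lambda>_. PiM J D)))
    {PiE I (\<lambda>i. PiE J (A i)) | A. \<forall>i\<in>I. \<forall>j\<in>J. A i j \<in> sets (D j)}" (is "sets ?M = sigma_sets ?\<Omega> ?E")
proof
  have sub: "?E \<subseteq> sets ?M" using assms by (auto intro!: sets_PiM_I_finite)
  then show "sigma_sets ?\<Omega> ?E \<subseteq> sets ?M" by (rule sets.sigma_sets_subset)
  have E: "?E \<subseteq> Pow ?\<Omega>" using sub sets.space_closed by blast
  \<comment> \<open>It is enough that each point projection is measurable from the generated
    sigma-algebra. The preimage of a one-coordinate cylinder is a box whose other sides are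
    full.\<close>
  define N where "N = sigma ?\<Omega> ?E"
  have N: "space N = ?\<Omega>" "sets N = sigma_sets ?\<Omega> ?E"
    using E by (simp_all add: N_def space_measure_of_conv)
  have "(\<lambda>q. q i) \<in> measurable N (PiM J D)" if i: "i \<in> I" for i
  proof (rule measurable_PiM_single)
    show "(\<lambda>q. q i) \<in> space N \<rightarrow> (\<Pi>\<^sub>E j\<in>J. space (D j))"
      using i by (auto simp: N space_PiM PiE_mem)
  next
    fix B j assume j: "j \<in> J" and B: "B \<in> sets (D j)"
    have "{q \<in> space N. q i j \<in> B} = PiE I (\<lambda>i'. PiE J (\<lambda>j'. if i' = i \<and> j' = j then B else space (D j')))"
    proof (rule set_eqI)
      fix q
      have "(\<forall>j'\<in>J. q i' j' \<in> (if i' = i \<and> j' = j then B else space (D j')))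
          \<longleftrightarrow> (\<forall>j'\<in>J. q i' j' \<in> space (D j')) \<and> (i' = i \<longrightarrow> q i j \<in> B)" for i'
        using j sets.sets_into_space[OF B] by (cases "i' = i") (auto split: if_splits)
      then show "q \<in> {q \<in> space N. q i j \<in> B} \<longleftrightarrow>
          q \<in> PiE I (\<lambda>i'. PiE J (\<lambda>j'. if i' = i \<and> j' = j then B else space (D j')))"
        using i unfolding N space_PiM PiE_iff mem_Collect_eq by blast
    qed
    also have "\<dots> \<in> ?E"
      using B by (intro CollectI exI[of _ "\<lambda>i' j'. if i' = i \<and> j' = j then B else space (D j')"]) auto
    finally show "{q \<in> space N. q i j \<in> B} \<in> sets N" unfolding N by (rule sigma_sets.Basic)
  qed
  then have "{q \<in> space N. q i \<in> B} \<in> sets N" if "i \<in> I" "B \<in> sets (PiM J D)" for i B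
    using measurable_sets[of "\<lambda>q. q i" N "PiM J D" B] that by (simp add: vimage_def Int_def conj_commute)
  then show "sets ?M \<subseteq> sigma_sets ?\<Omega> ?E"
    unfolding N(2)[symmetric] by (intro sets_PiM_in_sets) (simp_all add: N space_PiM)
qed

lemma measurable_PiM_PiM_component:
  assumes "i \<in> I" "j \<in> J"
  shows "(\<lambda>q. q i j) \<in> measurable (PiM I (\<lambda>_. PiM J D)) (D j)"
  using measurable_compose[OF measurable_component_singleton[OF assms(1), of "\<lambda>_. PiM J D"]
      measurable_component_singleton[OF assms(2), of D]] .

text \<open>The measure of a box is a double product, and \<open>\<pi> j\<close> only reorders the
  factors over \<open>I\<close> for fixed \<open>j\<close>. Boxes form an intersection-stable
  generator, which determines the measure.\<close>

lemma distr_shuffle_PiM_PiM: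
  fixes I :: "'i set" and J :: "'j set" and D :: "'j \<Rightarrow> 'a measure"
  assumes fin: "finite I" "finite J" and prob: "\<And>j. j \<in> J \<Longrightarrow> prob_space (D j)"
    and \<pi>: "\<pi> \<in> perms J I"
  defines "M \<equiv> PiM I (\<lambda>_. PiM J D)"
  defines "T \<equiv> (\<lambda>q. \<lambda>i\<in>I. \<lambda>j\<in>J. shuffle q \<pi> i j)"
  shows "T \<in> measurable M M" "distr M M T = M"
proof -
  \<comment> \<open>A point mass outside \<open>J\<close> makes every member of the family a
    probability space, as \<open>product_prob_space\<close> requires.\<close>
  define D' where "D' j = (if j \<in> J then D j else return (count_space UNIV) undefined)" for j
  have PD: "PiM J D = PiM J D'" by (rule PiM_cong) (auto simp: D'_def)
  have prob': "prob_space (D' j)" for j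
    using prob by (simp add: D'_def prob_space_return)
  then interpret D': product_prob_space D' J by (rule product_prob_spaceI)
  have probP: "prob_space (PiM J D')" by (rule prob_space_PiM) (rule prob')
  interpret PP: product_prob_space "\<lambda>_ :: 'i. PiM J D'" I by (rule product_prob_spaceI) (rule probP)
  have M: "M = PiM I (\<lambda>_. PiM J D')" by (simp add: M_def PD)
  interpret M: prob_space M unfolding M by (rule prob_space_PiM) (rule probP)
  have \<pi>I: "\<pi> j i \<in> I" if "i \<in> I" "j \<in> J" for i j
    using permsD[OF \<pi> that(2)] that(1) by (simp add: permutes_in_image)
  show T: "T \<in> measurable M M"
    unfolding M_def T_def shuffle_def
    by (intro measurable_restrict measurable_PiM_PiM_component \<pi>I)
  let ?E = "{PiE I (\<lambda>i. PiE J (A i)) | A. \<forall>i\<in>I. \<forall>j\<in>J. A i j \<in> sets (D j)}"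
  have box: "emeasure M (PiE I (\<lambda>i. PiE J (A i))) = (\<Prod>j\<in>J. \<Prod>i\<in>I. emeasure (D j) (A i j))"
    if A: "\<And>i j. i \<in> I \<Longrightarrow> j \<in> J \<Longrightarrow> A i j \<in> sets (D j)" for A
  proof -
    have A': "A i j \<in> sets (D' j)" if "i \<in> I" "j \<in> J" for i j using A that by (simp add: D'_def)
    have "emeasure M (PiE I (\<lambda>i. PiE J (A i))) = (\<Prod>i\<in>I. emeasure (PiM J D') (PiE J (A i)))"
      unfolding M using fin A' by (intro PP.emeasure_PiM) (auto intro!: sets_PiM_I_finite)
    also have "\<dots> = (\<Prod>i\<in>I. \<Prod>j\<in>J. emeasure (D' j) (A i j))"
      using fin A' by (intro prod.cong refl D'.emeasure_PiM) auto
    also have "\<dots> = (\<Prod>j\<in>J. \<Prod>i\<in>I. emeasure (D' j) (A i j))" by (rule prod.swap)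
    finally show ?thesis by (simp add: D'_def)
  qed
  show "distr M M T = M"
  proof (rule measure_eqI_generator_eq[where E = ?E and \<Omega> = "space M" and A = "\<lambda>_. space M"])
    show "Int_stable ?E"
    proof (rule Int_stableI, clarify)
      fix A B assume "\<forall>i\<in>I. \<forall>j\<in>J. A i j \<in> sets (D j)" "\<forall>i\<in>I. \<forall>j\<in>J. B i j \<in> sets (D j)"
      then show "\<exists>C. PiE I (\<lambda>i. PiE J (A i)) \<inter> PiE I (\<lambda>i. PiE J (B i)) = PiE I (\<lambda>i. PiE J (C i))
          \<and> (\<forall>i\<in>I. \<forall>j\<in>J. C i j \<in> sets (D j))"
        by (intro exI[of _ "\<lambda>i j. A i j \<inter> B i j"]) (auto simp: PiE_Int)
    qed
    have "?E \<subseteq> sets M" using fin unfolding M_def by (auto intro!: sets_PiM_I_finite)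
    then show "?E \<subseteq> Pow (space M)" using sets.space_closed by blast
    show sets: "sets M = sigma_sets (space M) ?E"
      unfolding M_def by (rule sets_PiM_PiM_eq_sigma_sets[OF fin])
    then show "sets (distr M M T) = sigma_sets (space M) ?E" by simp
    show "range (\<lambda>_. space M) \<subseteq> ?E"
      by (auto simp: M_def space_PiM intro!: exI[of _ "\<lambda>_ j. space (D j)"])
    show "(\<Union>i::nat. space M) = space M" by simp
    show "emeasure (distr M M T) (space M) \<noteq> \<infinity>" for i :: nat
      using T by (simp add: emeasure_distr M.emeasure_space_1)
    fix X assume "X \<in> ?E"
    then obtain A where X: "X = PiE I (\<lambda>i. PiE J (A i))" and A: "\<And>i j. i \<in> I \<Longrightarrow> j \<in> J \<Longrightarrow> A i j \<in> sets (D j)"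
      by auto
    have "X \<in> sets M" using fin A unfolding X M_def by (auto intro!: sets_PiM_I_finite)
    then have "emeasure (distr M M T) X = emeasure M (T -` X \<inter> space M)"
      using T by (simp add: emeasure_distr)
    \<comment> \<open>\<open>T\<close> reads the value at \<open>(i, j)\<close> into the position
      \<open>inv (\<pi> j) i\<close>, so this is the index of the constraint on it.\<close>
    also have "T -` X \<inter> space M = PiE I (\<lambda>i. PiE J (\<lambda>j. A (inv (\<pi> j) i) j))"
    proof (intro set_eqI iffI)
      have inv: "inv (\<pi> j) i \<in> I" "\<pi> j (inv (\<pi> j) i) = i" "inv (\<pi> j) (\<pi> j i) = i" if "i \<in> I" "j \<in> J" for i j
        using permsD[OF \<pi> that(2)] that(1)
        by (simp_all add: permutes_in_image[OF permutes_inv] permutes_inverses)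
      fix q
      {
        assume q: "q \<in> T -` X \<inter> space M"
        show "q \<in> PiE I (\<lambda>i. PiE J (\<lambda>j. A (inv (\<pi> j) i) j))"
        proof (intro PiE_I)
          fix i j assume ij: "i \<in> I" "j \<in> J"
          have "T q (inv (\<pi> j) i) j \<in> A (inv (\<pi> j) i) j"
            using q ij inv[OF ij] by (auto simp: X PiE_iff)
          then show "q i j \<in> A (inv (\<pi> j) i) j"
            using ij inv[OF ij] by (simp add: T_def shuffle_def)
        qed (use q in \<open>auto simp: M_def space_PiM PiE_iff extensional_def\<close>)
      }
      {
        assume q: "q \<in> PiE I (\<lambda>i. PiE J (\<lambda>j. A (inv (\<pi> j) i) j))"
        then have qA: "q i j \<in> A (inv (\<pi> j) i) j" if "i \<in> I" "j \<in> J" for i j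
          using that by (auto simp: PiE_iff)
        have "PiE I (\<lambda>i. PiE J (\<lambda>j. A (inv (\<pi> j) i) j)) \<subseteq> space M"
          unfolding M_def space_PiM by (intro PiE_mono sets.sets_into_space A inv)
        with q have "q \<in> space M" by blast
        moreover have "T q \<in> X"
        proof -
          have "q (\<pi> j i) j \<in> A i j" if "i \<in> I" "j \<in> J" for i j
            using qA[OF \<pi>I[OF that] that(2)] inv(3)[OF that] by simp
          then show ?thesis by (auto simp: X T_def shuffle_def)
        qed
        ultimately show "q \<in> T -` X \<inter> space M" by simp
      }
    qed
    also have "emeasure M \<dots> = (\<Prod>j\<in>J. \<Prod>i\<in>I. emeasure (D j) (A (inv (\<pi> j) i) j))"
      by (intro box A) (simp_all add: permutes_in_image[OF permutes_inv[OF permsD[OF \<pi>]]])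
    also have "\<dots> = (\<Prod>j\<in>J. \<Prod>i\<in>I. emeasure (D j) (A i j))"
    proof (rule prod.cong[OF refl])
      fix j assume "j \<in> J"
      then show "(\<Prod>i\<in>I. emeasure (D j) (A (inv (\<pi> j) i) j)) = (\<Prod>i\<in>I. emeasure (D j) (A i j))"
        using prod.permute[OF permutes_inv[OF permsD[OF \<pi>]], of j "\<lambda>i. emeasure (D j) (A i j)"]
        by (simp add: comp_def)
    qed
    also have "\<dots> = emeasure M X" unfolding X by (rule box[symmetric]) (rule A)
    finally show "emeasure (distr M M T) X = emeasure M X" .
  qed
qed

text \<open>By invariance every preimage of \<open>E\<close> under some \<open>T f\<close> has the
  probability of \<open>E\<close>. So \<open>prob E\<close> is the expectation of the proportion of
  maps that send the outcome into \<open>E\<close>.\<close>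

lemma (in prob_space) prob_le_of_AE_average_le:
  fixes T :: "'b \<Rightarrow> 'a \<Rightarrow> 'a" and \<epsilon> :: real
  assumes F: "finite F" "F \<noteq> {}" and E: "E \<in> events"
    and T: "\<And>f. f \<in> F \<Longrightarrow> T f \<in> measurable M M" "\<And>f. f \<in> F \<Longrightarrow> distr M M (T f) = M"
    and AE: "AE q in M. (\<Sum>f\<in>F. of_bool (T f q \<in> E)) \<le> \<epsilon> * real (card F)"
  shows "prob E \<le> \<epsilon>"
proof -
  have meas [measurable]: "T f -` E \<inter> space M \<in> events" if "f \<in> F" for f
    using measurable_sets[OF T(1)[OF that] E] .
  have prob: "prob (T f -` E \<inter> space M) = prob E" if "f \<in> F" for f
    using measure_distr[OF T(1)[OF that] E] T(2)[OF that] by simp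
  have int: "integrable M (indicat_real (T f -` E \<inter> space M))" if "f \<in> F" for f
    using meas[OF that] by (simp add: integrable_indicator_iff less_top[symmetric])
  have "real (card F) * prob E = (\<Sum>f\<in>F. \<integral>q. indicat_real (T f -` E \<inter> space M) q \<partial>M)"
    by (simp add: prob Int_assoc)
  also have "\<dots> = (\<integral>q. (\<Sum>f\<in>F. indicat_real (T f -` E \<inter> space M) q) \<partial>M)"
    by (rule Bochner_Integration.integral_sum[symmetric]) (rule int)
  also have "\<dots> \<le> (\<integral>q. \<epsilon> * real (card F) \<partial>M)"
  proof (rule integral_mono_AE)
    show "AE q in M. (\<Sum>f\<in>F. indicat_real (T f -` E \<inter> space M) q) \<le> \<epsilon> * real (card F)"
      using AE AE_space
    proof eventually_elim
      case (elim q)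
      then show ?case by (simp add: indicator_def of_bool_def cong: if_cong)
    qed
  qed (auto intro!: Bochner_Integration.integrable_sum int)
  also have "\<dots> = real (card F) * \<epsilon>" by (simp add: prob_space)
  finally show ?thesis using F by (simp add: card_gt_0_iff)
qed

subsection \<open>Staircases of the sample\<close>

text \<open>Counting each point at its first index writes the cardinality as a finite sum of
  indicators even when points coincide. Measurability has to be shown on the whole space, not only
  almost everywhere.\<close>

lemma card_eq_card_first_occurrences:
  fixes q :: "nat \<Rightarrow> 'a"
  assumes "U \<subseteq> q ` {1..n}"
  shows "card U = card {k\<in>{1..n}. q k \<in> U \<and> (\<forall>l\<in>{1..<k}. q l \<noteq> q k)}" (is "_ = card ?K")
proof (rule bij_betw_same_card[symmetric])
  show "bij_betw q ?K U"
  proof (rule bij_betwI')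
    fix k l assume "k \<in> ?K" "l \<in> ?K"
    then show "q k = q l \<longleftrightarrow> k = l"
      by (cases k l rule: linorder_cases) auto
  next
    fix u assume u: "u \<in> U"
    define k where "k = (LEAST k. k \<in> {1..n} \<and> q k = u)"
    have ex: "\<exists>k. k \<in> {1..n} \<and> q k = u" using u assms by (metis imageE subsetD)
    have k: "k \<in> {1..n}" "q k = u" using LeastI_ex[OF ex] unfolding k_def by auto
    have "q l \<noteq> u" if "l \<in> {1..<k}" for l
      using not_less_Least[of l "\<lambda>k. k \<in> {1..n} \<and> q k = u"] that k(1) unfolding k_def by auto
    then show "\<exists>k\<in>?K. u = q k" using k u by auto
  qed simp
qed

lemma staircase_image:
  assumes "inj_on z I"
  shows "staircase d (z ` I) = z ` minima I {1..d} z"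
  using inj_on_eq_iff[OF assms] by (auto simp: staircase_def minima_def dominates_def)

text \<open>Shrinking a set only removes competitors, so a point on the staircase of some prefix is
  already on that of the prefix ending with it. By \<open>minima_insert\<close> the index then acts
  as coordinate \<open>Suc d\<close>.\<close>

lemma UN_staircase_prefixes:
  assumes "inj_on z {1..n}"
  shows "(\<Union>i\<in>{1..n}. staircase d (z ` {1..i}))
    = z ` minima {1..n} {1..Suc d} (\<lambda>i j. if j = Suc d then real i else z i j)"
proof -
  let ?z = "\<lambda>i j. if j = Suc d then real i else z i j"
  have "(\<Union>i\<in>{1..n}. staircase d (z ` {1..i})) = (\<Union>i\<in>{1..n}. z ` minima {1..i} {1..d} z)"
    using inj_on_subset[OF assms] by (intro SUP_cong refl staircase_image) auto
  also have "\<dots> = z ` {k\<in>{1..n}. k \<in> minima {1..k} {1..d} z}"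
    by (force simp: minima_def)
  also have "{k\<in>{1..n}. k \<in> minima {1..k} {1..d} z} = {k\<in>{1..n}. k \<in> minima {l\<in>{1..n}. ?z l (Suc d) \<le> ?z k (Suc d)} {1..d} ?z}"
  proof (intro Collect_cong conj_cong refl)
    fix k assume "k \<in> {1..n}"
    then have "{l\<in>{1..n}. ?z l (Suc d) \<le> ?z k (Suc d)} = {1..k}" by auto
    moreover have "minima {1..k} {1..d} ?z = minima {1..k} {1..d} z"
      by (rule minima_cong) auto
    ultimately show "k \<in> minima {1..k} {1..d} z \<longleftrightarrow>
        k \<in> minima {l\<in>{1..n}. ?z l (Suc d) \<le> ?z k (Suc d)} {1..d} ?z" by simp
  qed
  also have "\<dots> = minima {1..n} {1..Suc d} ?z"
  proof -
    have "{1..Suc d} = insert (Suc d) {1..d}" by auto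
    then show ?thesis by (simp only: minima_insert)
  qed
  finally show ?thesis .
qed

text \<open>Unlike \<open>shuffle\<close>, one permutation moves entire rows here, which only
  renames the points.\<close>

lemma card_minima_relabel:
  assumes "p permutes I"
  shows "card (minima I J (\<lambda>i. z (p i))) = card (minima I J z)"
proof -
  have "minima I J z = p ` minima I J (\<lambda>i. z (p i))"
  proof -
    have "minima (p ` I) J z = p ` minima I J (\<lambda>i. z (p i))"
      using permutes_inj[OF assms] by (auto simp: minima_def inj_eq)
    then show ?thesis by (simp add: permutes_image[OF assms])
  qed
  then show ?thesis
    using permutes_inj[OF assms] by (simp add: card_image inj_on_subset)
qed

context
  fixes d n :: nat and D :: "nat \<Rightarrow> real measure"
  assumes d: "d \<ge> 1" and D: "\<And>j. j \<in> {1..d} \<Longrightarrow> atomless_unit_distribution (D j)"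
begin

lemma prob_space_D: "j \<in> {1..d} \<Longrightarrow> prob_space (D j)"
  and sets_D: "j \<in> {1..d} \<Longrightarrow> sets (D j) = sets borel"
  using D[of j] by (auto simp: atomless_unit_distribution_def real_distribution_def real_distribution_axioms_def)

lemma prob_space_sample_measure: "prob_space (sample_measure d D n)"
  unfolding sample_measure_def point_measure_of_def
  by (intro prob_space_PiM prob_space_D)

interpretation prob_space "sample_measure d D n" by (rule prob_space_sample_measure)

lemma AE_distinct: "AE q in sample_measure d D n. inj_on (\<lambda>(i, j). q i j) ({1..n} \<times> {1..d})"
  by (rule AE_sample_distinct) (rule D)

lemma inj_on_component:
  assumes "inj_on (\<lambda>(i, j). q i j) ({1..n} \<times> {1..d})" "j \<in> {1..d}"
  shows "inj_on (\<lambda>i. q i j) {1..n}"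
proof (rule inj_onI)
  fix i k assume "i \<in> {1..n}" "k \<in> {1..n}" "q i j = q k j"
  then show "i = k" using inj_onD[OF assms(1), of "(i, j)" "(k, j)"] assms(2) by simp
qed

section \<open>Measurability of the staircase events\<close>

lemma measurable_sample_component:
  assumes "i \<in> {1..n}" "j \<in> {1..d}"
  shows "(\<lambda>q. q i j) \<in> borel_measurable (sample_measure d D n)"
  using measurable_PiM_PiM_component[OF assms, of D]
  unfolding sample_measure_def point_measure_of_def by (simp only: measurable_cong_sets[OF refl sets_D[OF assms(2)]])

lemma pred_component_eq:
  assumes "i \<in> {1..n}" "k \<in> {1..n}" "j \<in> {1..d}"
  shows "Measurable.pred (sample_measure d D n) (\<lambda>q. q i j = q k j)"
  unfolding pred_def using assms by (intro borel_measurable_eq measurable_sample_component)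

lemma pred_component_le:
  assumes "i \<in> {1..n}" "k \<in> {1..n}" "j \<in> {1..d}"
  shows "Measurable.pred (sample_measure d D n) (\<lambda>q. q i j \<le> q k j)"
  unfolding pred_def using assms by (intro borel_measurable_le measurable_sample_component)

text \<open>Points of the sample space are extensional, so their equality is a finite conjunction
  over the coordinates.\<close>

lemma pred_points_eq:
  assumes "i \<in> {1..n}" "k \<in> {1..n}"
  shows "Measurable.pred (sample_measure d D n) (\<lambda>q. q i = q k)"
proof -
  have "Measurable.pred (sample_measure d D n) (\<lambda>q. \<forall>j\<in>{1..d}. q i j = q k j)"
    using assms
    by (intro pred_intros_finite finite_atLeastAtMost pred_component_eq)
  also have "?this \<longleftrightarrow> ?thesis"
  proof (intro measurable_cong)
    fix q assume "q \<in> space (sample_measure d D n)"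
    then have "q i \<in> extensional {1..d}" "q k \<in> extensional {1..d}"
      using assms by (auto simp: sample_measure_def point_measure_of_def space_PiM PiE_iff)
    then show "(\<forall>j\<in>{1..d}. q i j = q k j) \<longleftrightarrow> q i = q k"
      by (auto intro: extensionalityI)
  qed
  finally show ?thesis .
qed

lemma pred_mem_staircase:
  assumes "k \<in> {1..n}" "i \<in> {1..n}"
  shows "Measurable.pred (sample_measure d D n) (\<lambda>q. q k \<in> staircase d (q ` {1..i}))"
proof -
  have i: "l \<in> {1..n}" if "l \<in> {1..i}" for l using assms that by auto
  \<comment> \<open>For \<open>k > i\<close> the point \<open>q k\<close> is in the prefix only by
    coincidence with an earlier point, so membership is itself an event.\<close>
  have "Measurable.pred (sample_measure d D n) (\<lambda>q. (\<exists>l\<in>{1..i}. q k = q l) \<and>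
      \<not> (\<exists>l\<in>{1..i}. q l \<noteq> q k \<and> (\<forall>j\<in>{1..d}. q l j \<le> q k j)))"
    by (intro pred_intros_logic pred_intros_finite finite_atLeastAtMost pred_points_eq assms i
        pred_component_le)
  also have "(\<lambda>q. (\<exists>l\<in>{1..i}. q k = q l) \<and> \<not> (\<exists>l\<in>{1..i}. q l \<noteq> q k \<and> (\<forall>j\<in>{1..d}. q l j \<le> q k j)))
      = (\<lambda>q. q k \<in> staircase d (q ` {1..i}))"
    unfolding staircase_def dominates_def by (intro ext) blast
  finally show ?thesis .
qed

lemma events_card_less:
  fixes U :: "(nat \<Rightarrow> nat \<Rightarrow> real) \<Rightarrow> (nat \<Rightarrow> real) set" and t :: real
  assumes U: "\<And>q. U q \<subseteq> q ` {1..n}"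
    and pred: "\<And>k. k \<in> {1..n} \<Longrightarrow> Measurable.pred (sample_measure d D n) (\<lambda>q. q k \<in> U q)"
  shows "{q \<in> space (sample_measure d D n). t < real (card (U q))} \<in> events"
proof -
  have "(\<lambda>q. \<Sum>k\<in>{1..n}. of_bool (q k \<in> U q \<and> (\<forall>l\<in>{1..<k}. q l \<noteq> q k)) :: real)
      \<in> borel_measurable (sample_measure d D n)"
  proof (intro borel_measurable_sum)
    fix k assume k: "k \<in> {1..n}"
    have "Measurable.pred (sample_measure d D n) (\<lambda>q. q k \<in> U q \<and> (\<forall>l\<in>{1..<k}. q l \<noteq> q k))"
      using k by (intro pred_intros_logic pred_intros_finite finite_atLeastLessThan pred_points_eq pred) auto
    then show "(\<lambda>q. of_bool (q k \<in> U q \<and> (\<forall>l\<in>{1..<k}. q l \<noteq> q k)) :: real)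
        \<in> borel_measurable (sample_measure d D n)"
      by measurable
  qed
  also have "(\<lambda>q. \<Sum>k\<in>{1..n}. of_bool (q k \<in> U q \<and> (\<forall>l\<in>{1..<k}. q l \<noteq> q k)) :: real) = (\<lambda>q. real (card (U q)))"
    by (simp add: card_eq_card_first_occurrences[OF U] Int_def conj_commute)
  finally show ?thesis by measurable
qed

section \<open>Transfer of the permutation bounds to the random sample\<close>

abbreviation "shuffled_sample \<sigma> q \<equiv> \<lambda>i\<in>{1..n}. \<lambda>j\<in>{1..d}. shuffle q \<sigma> i j"

lemma distr_shuffled_sample:
  assumes "\<sigma> \<in> perms {1..d} {1..n}"
  shows "shuffled_sample \<sigma> \<in> measurable (sample_measure d D n) (sample_measure d D n)"
    "distr (sample_measure d D n) (sample_measure d D n) (shuffled_sample \<sigma>) = sample_measure d D n"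
proof -
  note shuffle = distr_shuffle_PiM_PiM[where D = D, OF finite_atLeastAtMost finite_atLeastAtMost _ assms]
  show "shuffled_sample \<sigma> \<in> measurable (sample_measure d D n) (sample_measure d D n)"
    unfolding sample_measure_def point_measure_of_def by (rule shuffle(1), erule prob_space_D)
  show "distr (sample_measure d D n) (sample_measure d D n) (shuffled_sample \<sigma>) = sample_measure d D n"
    unfolding sample_measure_def point_measure_of_def by (rule shuffle(2), erule prob_space_D)
qed

text \<open>Coordinate 1 already separates the points: its values are distinct and
  \<open>\<sigma> 1\<close> is injective.\<close>

lemma inj_on_shuffled_sample:
  assumes \<sigma>: "\<sigma> \<in> perms {1..d} {1..n}" and q: "inj_on (\<lambda>(i, j). q i j) ({1..n} \<times> {1..d})"
  shows "inj_on (shuffled_sample \<sigma> q) {1..n}"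
proof (rule inj_onI)
  fix i k assume ik: "i \<in> {1..n}" "k \<in> {1..n}" and eq: "shuffled_sample \<sigma> q i = shuffled_sample \<sigma> q k"
  have p: "\<sigma> 1 permutes {1..n}" using \<sigma> d by (intro permsD) auto
  have "shuffled_sample \<sigma> q i 1 = shuffled_sample \<sigma> q k 1" using eq by simp
  then have "q (\<sigma> 1 i) 1 = q (\<sigma> 1 k) 1" using ik d by (simp add: shuffle_def)
  then have "\<sigma> 1 i = \<sigma> 1 k"
    using inj_onD[OF q, of "(\<sigma> 1 i, 1)" "(\<sigma> 1 k, 1)"] permutes_in_image[OF p] ik d by auto
  then show "i = k" using permutes_inj[OF p] by (simp add: inj_eq)
qed

text \<open>Almost surely all values are distinct, so \<open>H\<close> applies to the sampled array
  itself; invariance under shuffling turns this proportion into a probability.\<close>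

lemma prob_staircase_gt_le:
  fixes t \<epsilon> :: real
  assumes n: "n \<ge> 1"
    and H: "\<And>x. (\<And>j. j \<in> {1..d} \<Longrightarrow> inj_on (\<lambda>i. x i j) {1..n}) \<Longrightarrow>
      (\<Sum>\<pi>\<in>perms {1..d} {1..n}. of_bool (t < real (card (minima {1..n} {1..d} (shuffle x \<pi>)))))
        \<le> \<epsilon> * real (card (perms {1..d} {1..n}))"
  defines "E \<equiv> {q \<in> space (sample_measure d D n). t < real (card (staircase d (q ` {1..n})))}"
  shows "E \<in> events" "prob E \<le> \<epsilon>"
proof -
  show E: "E \<in> events"
    unfolding E_def using n by (intro events_card_less pred_mem_staircase) (auto simp: staircase_def)
  have ne: "card (perms {1..d} {1..n}) \<noteq> 0" by (simp add: card_perms)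
  show "prob E \<le> \<epsilon>"
  proof (rule prob_le_of_AE_average_le[where T = shuffled_sample, OF _ _ E distr_shuffled_sample])
    show "finite (perms {1..d} {1..n})" "perms {1..d} {1..n} \<noteq> {}" using ne by (auto intro: card_ge_0_finite)
    show "AE q in sample_measure d D n. (\<Sum>\<pi>\<in>perms {1..d} {1..n}. of_bool (shuffled_sample \<pi> q \<in> E))
        \<le> \<epsilon> * real (card (perms {1..d} {1..n}))"
      using AE_distinct
    proof eventually_elim
      case (elim q)
      have "(\<Sum>\<pi>\<in>perms {1..d} {1..n}. of_bool (shuffled_sample \<pi> q \<in> E))
        \<le> (\<Sum>\<pi>\<in>perms {1..d} {1..n}. of_bool (t < real (card (minima {1..n} {1..d} (shuffle q \<pi>)))) :: real)"
      proof (rule sum_mono)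
        fix \<pi> assume \<pi>: "\<pi> \<in> perms {1..d} {1..n}"
        note inj = inj_on_shuffled_sample[OF \<pi> elim]
        have "card (staircase d (shuffled_sample \<pi> q ` {1..n})) = card (minima {1..n} {1..d} (shuffled_sample \<pi> q))"
          unfolding staircase_image[OF inj] by (intro card_image inj_on_subset[OF inj] minima_subset)
        also have "minima {1..n} {1..d} (shuffled_sample \<pi> q) = minima {1..n} {1..d} (shuffle q \<pi>)"
          by (rule minima_cong) simp
        finally have "t < real (card (minima {1..n} {1..d} (shuffle q \<pi>)))" if "shuffled_sample \<pi> q \<in> E"
          using that unfolding E_def mem_Collect_eq by (simp only:)
        then show "of_bool (shuffled_sample \<pi> q \<in> E)
            \<le> (of_bool (t < real (card (minima {1..n} {1..d} (shuffle q \<pi>)))) :: real)"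
          by simp
      qed
      also have "\<dots> \<le> \<epsilon> * real (card (perms {1..d} {1..n}))"
      proof (rule H)
        fix j assume "j \<in> {1..d}"
        then show "inj_on (\<lambda>i. q i j) {1..n}" by (rule inj_on_component[OF elim])
      qed
      finally show ?case .
    qed
  qed
qed

text \<open>The average runs over tuples with one more entry than the sample has coordinates. Many
  tuples act alike on the sample, which \<open>prob_le_of_AE_average_le\<close> permits.\<close>

lemma prob_UN_staircase_gt_le:
  fixes t \<epsilon> :: real
  assumes H: "\<And>x. (\<And>j. j \<in> {1..Suc d} \<Longrightarrow> inj_on (\<lambda>i. x i j) {1..n}) \<Longrightarrow>
      (\<Sum>\<pi>\<in>perms {1..Suc d} {1..n}. of_bool (t < real (card (minima {1..n} {1..Suc d} (shuffle x \<pi>)))))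
        \<le> \<epsilon> * real (card (perms {1..Suc d} {1..n}))"
  defines "E \<equiv> {q \<in> space (sample_measure d D n). t < real (card (\<Union>i\<in>{1..n}. staircase d (q ` {1..i})))}"
  shows "E \<in> events" "prob E \<le> \<epsilon>"
proof -
  show E: "E \<in> events"
    unfolding E_def
  proof (intro events_card_less)
    fix q :: "nat \<Rightarrow> nat \<Rightarrow> real"
    show "(\<Union>i\<in>{1..n}. staircase d (q ` {1..i})) \<subseteq> q ` {1..n}"
      by (force simp: staircase_def)
  next
    fix k assume k: "k \<in> {1..n}"
    have "Measurable.pred (sample_measure d D n) (\<lambda>q. \<exists>i\<in>{1..n}. q k \<in> staircase d (q ` {1..i}))"
      by (intro pred_intros_finite finite_atLeastAtMost pred_mem_staircase k)
    then show "Measurable.pred (sample_measure d D n) (\<lambda>q. q k \<in> (\<Union>i\<in>{1..n}. staircase d (q ` {1..i})))"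
      by (simp only: UN_iff)
  qed
  text \<open>The arrival time acts as a further coordinate; relabelling the points makes it the identity permutation.\<close>
  define \<sigma> where "\<sigma> \<pi> = (\<lambda>j\<in>{1..d}. \<pi> j \<circ> inv (\<pi> (Suc d)))" for \<pi> :: "nat \<Rightarrow> nat \<Rightarrow> nat"
  have \<sigma>: "\<sigma> \<pi> \<in> perms {1..d} {1..n}" if "\<pi> \<in> perms {1..Suc d} {1..n}" for \<pi>
    using permsD[OF that] by (auto simp: perms_def \<sigma>_def intro!: permutes_compose permutes_inv)
  have ne: "card (perms {1..Suc d} {1..n}) \<noteq> 0" by (simp add: card_perms)
  show "prob E \<le> \<epsilon>"
  proof (rule prob_le_of_AE_average_le[where T = "\<lambda>\<pi>. shuffled_sample (\<sigma> \<pi>)", OF _ _ E distr_shuffled_sample[OF \<sigma>]])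
    show "finite (perms {1..Suc d} {1..n})" "perms {1..Suc d} {1..n} \<noteq> {}" using ne by (auto intro: card_ge_0_finite)
    show "AE q in sample_measure d D n. (\<Sum>\<pi>\<in>perms {1..Suc d} {1..n}. of_bool (shuffled_sample (\<sigma> \<pi>) q \<in> E))
        \<le> \<epsilon> * real (card (perms {1..Suc d} {1..n}))"
      using AE_distinct
    proof eventually_elim
      case (elim q)
      define x where "x i j = (if j = Suc d then real i else q i j)" for i j
      have "(\<Sum>\<pi>\<in>perms {1..Suc d} {1..n}. of_bool (shuffled_sample (\<sigma> \<pi>) q \<in> E))
        \<le> (\<Sum>\<pi>\<in>perms {1..Suc d} {1..n}. of_bool (t < real (card (minima {1..n} {1..Suc d} (shuffle x \<pi>)))) :: real)"
      proof (rule sum_mono)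
        fix \<pi> assume \<pi>: "\<pi> \<in> perms {1..Suc d} {1..n}"
        define p where "p = \<pi> (Suc d)"
        have p: "p permutes {1..n}" unfolding p_def using \<pi> by (rule permsD) simp
        define z where "z i j = (if j = Suc d then real i else shuffled_sample (\<sigma> \<pi>) q i j)" for i j
        note inj = inj_on_shuffled_sample[OF \<sigma>[OF \<pi>] elim]
        have "card (\<Union>i\<in>{1..n}. staircase d (shuffled_sample (\<sigma> \<pi>) q ` {1..i})) = card (minima {1..n} {1..Suc d} z)"
          unfolding UN_staircase_prefixes[OF inj] z_def
          by (intro card_image inj_on_subset[OF inj] minima_subset)
        also have "\<dots> = card (minima {1..n} {1..Suc d} (\<lambda>i. z (p i)))"
          by (rule card_minima_relabel[OF p, symmetric])
        \<comment> \<open>Relabelling by \<open>p\<close> cancels the inverse inside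
          \<open>\<sigma> \<pi>\<close> and puts \<open>p i\<close> into the time coordinate, which
          is what \<open>shuffle x \<pi>\<close> has there.\<close>
        also have "minima {1..n} {1..Suc d} (\<lambda>i. z (p i)) = minima {1..n} {1..Suc d} (shuffle x \<pi>)"
        proof (rule minima_cong)
          fix i j assume "i \<in> {1..n}" "j \<in> {1..Suc d}"
          moreover from this(1) have "p i \<in> {1..n}" by (simp only: permutes_in_image[OF p])
          ultimately show "z (p i) j = shuffle x \<pi> i j"
            using permutes_inverses(2)[OF p]
            by (auto simp: z_def x_def shuffle_def \<sigma>_def p_def[symmetric])
        qed
        finally have "t < real (card (minima {1..n} {1..Suc d} (shuffle x \<pi>)))" if "shuffled_sample (\<sigma> \<pi>) q \<in> E"
          using that unfolding E_def mem_Collect_eq by (simp only:)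
        then show "of_bool (shuffled_sample (\<sigma> \<pi>) q \<in> E)
            \<le> (of_bool (t < real (card (minima {1..n} {1..Suc d} (shuffle x \<pi>)))) :: real)"
          by simp
      qed
      also have "\<dots> \<le> \<epsilon> * real (card (perms {1..Suc d} {1..n}))"
      proof (rule H)
        fix j assume "j \<in> {1..Suc d}"
        then show "inj_on (\<lambda>i. x i j) {1..n}"
          using inj_on_component[OF elim, of j] by (cases "j = Suc d") (auto simp: x_def inj_on_def[of real])
      qed
      finally show ?case .
    qed
  qed
qed

end

theorem lemma6p4:
  fixes d :: nat
  assumes "d \<ge> 2"
  shows "\<exists>c::real. \<forall>\<gamma>::real. \<gamma> > 0 \<longrightarrow> (\<exists>C::real.
    \<forall>(D :: nat \<Rightarrow> real measure) (n :: nat).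
      (\<forall>j\<in>{1..d}. atomless_unit_distribution (D j)) \<longrightarrow> n \<ge> 2 \<longrightarrow>
      measure (sample_measure d D n)
        {q \<in> space (sample_measure d D n).
          real (card (\<Union>i\<in>{1..n}. staircase d (q ` {1..i}))) \<le> C * c * ln (real n) ^ d}
        \<ge> 1 - real n powr (- \<gamma>) \<and>
      measure (sample_measure d D n)
        {q \<in> space (sample_measure d D n).
          real (card (staircase d (q ` {1..n}))) \<le> C * c * ln (real n) ^ (d - 1)}
        \<ge> 1 - real n powr (- \<gamma>))"
proof (rule exI[of _ 1], intro allI impI)
  \<comment> \<open>The witness for \<open>c\<close> is 1: \<open>C\<close> may depend on
    \<open>d\<close> and carries the whole constant.\<close>
  fix \<gamma> :: real assume \<gamma>: "\<gamma> > 0"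
  have "{1..d} \<noteq> {}" "{1..Suc d} \<noteq> {}" using assms by auto
  note tails = this[THEN minima_tail[OF finite_atLeastAtMost _ \<gamma>, where 'i = nat]]
  \<comment> \<open>One \<open>C\<close> serves both claims: \<open>d\<close> coordinates give the
    exponent \<open>d - 1\<close> for the staircase, and the arrival time as coordinate
    \<open>Suc d\<close> gives \<open>d\<close> for the union.\<close>
  obtain C where C: "\<forall>n\<ge>2. \<forall>(I :: nat set) x. finite I \<longrightarrow> card I \<le> n \<longrightarrow> (\<forall>j\<in>{1..d}. inj_on (\<lambda>i. x i j) I) \<longrightarrow>
      (\<Sum>\<pi>\<in>perms {1..d} I. of_bool (C * ln (real n) ^ (card {1..d} - 1) < real (card (minima I {1..d} (shuffle x \<pi>)))))
        \<le> real n powr (- \<gamma>) * real (card (perms {1..d} I))"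
    "\<forall>n\<ge>2. \<forall>(I :: nat set) x. finite I \<longrightarrow> card I \<le> n \<longrightarrow> (\<forall>j\<in>{1..Suc d}. inj_on (\<lambda>i. x i j) I) \<longrightarrow>
      (\<Sum>\<pi>\<in>perms {1..Suc d} I. of_bool (C * ln (real n) ^ (card {1..Suc d} - 1) < real (card (minima I {1..Suc d} (shuffle x \<pi>)))))
        \<le> real n powr (- \<gamma>) * real (card (perms {1..Suc d} I))"
    using eventually_happens'[OF trivial_limit_at_top_linorder eventually_conj[OF tails]] by blast
  have cards: "card {1..d} - 1 = d - 1" "card {1..Suc d} - 1 = d" by simp_all
  show "\<exists>C. \<forall>(D :: nat \<Rightarrow> real measure) (n :: nat).
      (\<forall>j\<in>{1..d}. atomless_unit_distribution (D j)) \<longrightarrow> n \<ge> 2 \<longrightarrow>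
      measure (sample_measure d D n)
        {q \<in> space (sample_measure d D n).
          real (card (\<Union>i\<in>{1..n}. staircase d (q ` {1..i}))) \<le> C * 1 * ln (real n) ^ d}
        \<ge> 1 - real n powr (- \<gamma>) \<and>
      measure (sample_measure d D n)
        {q \<in> space (sample_measure d D n).
          real (card (staircase d (q ` {1..n}))) \<le> C * 1 * ln (real n) ^ (d - 1)}
        \<ge> 1 - real n powr (- \<gamma>)"
  proof (intro exI[of _ C] allI impI)
    fix D :: "nat \<Rightarrow> real measure" and n :: nat
    assume D: "\<forall>j\<in>{1..d}. atomless_unit_distribution (D j)" and n: "n \<ge> 2"
    let ?M = "sample_measure d D n"
    have d: "d \<ge> 1" using assms by simp
    interpret prob_space ?M
      by (rule prob_space_sample_measure[OF d]) (erule D[rule_format])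
    have compl: "prob {q \<in> space ?M. f q \<le> C * 1 * l} \<ge> 1 - e"
      if "{q \<in> space ?M. C * l < f q} \<in> events" "prob {q \<in> space ?M. C * l < f q} \<le> e" for f l e
    proof -
      have "{q \<in> space ?M. f q \<le> C * 1 * l} = space ?M - {q \<in> space ?M. C * l < f q}" by auto
      then show ?thesis using prob_compl[OF that(1)] that(2) by simp
    qed
    show "prob {q \<in> space ?M. real (card (\<Union>i\<in>{1..n}. staircase d (q ` {1..i}))) \<le> C * 1 * ln (real n) ^ d}
        \<ge> 1 - real n powr (- \<gamma>)
      \<and> prob {q \<in> space ?M. real (card (staircase d (q ` {1..n}))) \<le> C * 1 * ln (real n) ^ (d - 1)}
        \<ge> 1 - real n powr (- \<gamma>)"
    proof (intro conjI compl)
      note C1 = C(1)[rule_format, unfolded cards, OF n finite_atLeastAtMost[of 1 n]]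
      note C2 = C(2)[rule_format, unfolded cards, OF n finite_atLeastAtMost[of 1 n]]
      have n1: "n \<ge> 1" using n by simp
      note UN = prob_UN_staircase_gt_le[OF d, where t = "C * ln (real n) ^ d" and \<epsilon> = "real n powr (- \<gamma>)"]
      note St = prob_staircase_gt_le[OF d _ n1, where t = "C * ln (real n) ^ (d - 1)" and \<epsilon> = "real n powr (- \<gamma>)"]
      show "{q \<in> space ?M. C * ln (real n) ^ d < real (card (\<Union>i\<in>{1..n}. staircase d (q ` {1..i})))} \<in> events"
        by (rule UN(1), erule D[rule_format]) (rule C2; simp)
      show "prob {q \<in> space ?M. C * ln (real n) ^ d < real (card (\<Union>i\<in>{1..n}. staircase d (q ` {1..i})))} \<le> real n powr (- \<gamma>)"
        by (rule UN(2), erule D[rule_format]) (rule C2; simp)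
      show "{q \<in> space ?M. C * ln (real n) ^ (d - 1) < real (card (staircase d (q ` {1..n})))} \<in> events"
        by (rule St(1), erule D[rule_format]) (rule C1; simp)
      show "prob {q \<in> space ?M. C * ln (real n) ^ (d - 1) < real (card (staircase d (q ` {1..n})))} \<le> real n powr (- \<gamma>)"
        by (rule St(2), erule D[rule_format]) (rule C1; simp)
    qed
  qed
qed

end
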